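(* For every $n\ge3$, $q_M(C_n)=\lceil n/2\rceil$, where $C_n$ is the cycle on $n$ vertices.
   Context: For a graph $G$ on $\{1,\dots,n\}$, $\mathcal{S}(G)$ is the set of real symmetric $n\times n$ matrices $A=(a_{ij})$ with $a_{ij}\ne0$ iff $ij\in E(G)$ for $i\ne j$. $q(A)$ is the number of distinct eigenvalues of $A$. $\circ$ is the entrywise product. A real symmetric $n\times n$ matrix $A$ has the Strong Multiplicity Property (SMP) if the only real symmetric $X$ with $A\circ X=O$, $I\circ X=O$, $AX-XA=O$ and $\operatorname{tr}(A^iX)=0$ for $i=0,\dots,n-1$ is $X=O$. $q_M(G)=\min\{q(A): A\in\mathcal{S}(G),\ A \text{ has the SMP}\}$. *)

theory Defs
  imports Complex_Main "Jordan_Normal_Form.Spectral_Radius"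
begin

text \<open>
  A graph on \<open>n\<close> vertices is given by the number \<open>n\<close> and a set \<open>E\<close> of edges, each edge being a
  two-element set \<open>{i, j}\<close>. Vertices are numbered \<open>0, \<dots>, n - 1\<close> to agree with the row and column
  indices of matrices.
\<close>

definition cycle_edges :: "nat \<Rightarrow> nat set set" where
  "cycle_edges n = {{i, (i + 1) mod n} | i. i < n}"

definition sym_mats :: "nat \<Rightarrow> real mat set" where
  "sym_mats n = {A \<in> carrier_mat n n. transpose_mat A = A}"

definition graph_mats :: "nat \<Rightarrow> nat set set \<Rightarrow> real mat set" where
  "graph_mats n E =
     {A \<in> sym_mats n. \<forall>i<n. \<forall>j<n. i \<noteq> j \<longrightarrow> (A $$ (i, j) \<noteq> 0 \<longleftrightarrow> {i, j} \<in> E)}"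

text \<open>Only real eigenvalues are counted; for symmetric matrices these are all of them.\<close>

definition num_eigenvalues :: "real mat \<Rightarrow> nat" where
  "num_eigenvalues A = card (spectrum A)"

definition hadamard :: "real mat \<Rightarrow> real mat \<Rightarrow> real mat" where
  "hadamard A B = mat (dim_row A) (dim_col A) (\<lambda>(i, j). A $$ (i, j) * B $$ (i, j))"

definition mat_trace :: "real mat \<Rightarrow> real" where
  "mat_trace A = (\<Sum>i<dim_row A. A $$ (i, i))"

definition has_SMP :: "nat \<Rightarrow> real mat \<Rightarrow> bool" where
  "has_SMP n A \<longleftrightarrow> A \<in> sym_mats n \<and>
     (\<forall>X \<in> sym_mats n.
        hadamard A X = 0\<^sub>m n n \<and> hadamard (1\<^sub>m n) X = 0\<^sub>m n n \<and>
        A * X - X * A = 0\<^sub>m n n \<and>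
        (\<forall>i<n. mat_trace (A ^\<^sub>m i * X) = 0) \<longrightarrow> X = 0\<^sub>m n n)"

text \<open>\<^const>\<open>Inf\<close> of a nonempty set of natural numbers is its minimum; that of the empty set is left
  unspecified by the library.\<close>

definition q_M :: "nat \<Rightarrow> nat set set \<Rightarrow> nat" where
  "q_M n E = Inf {num_eigenvalues A | A. A \<in> graph_mats n E \<and> has_SMP n A}"

end

theory Submission
  imports Defs
begin

text \<open>
  Lower bound: for a matrix \<open>A\<close> of the cycle and \<open>2 q < n\<close>, a product of \<open>q\<close> factors \<open>A - a\<close> has a
  nonzero entry at position \<open>(q, 0)\<close>, because only one walk of length \<open>q\<close> joins these two
  vertices. But for symmetric \<open>A\<close> the product over the spectrum vanishes.

  Upper bound: let \<open>C\<close> be the adjacency matrix of the cycle with the sign of one edge reversed. Its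
  eigenvectors are the \<open>n\<close>-antiperiodic sequences \<open>f\<close> with \<open>f (k + 1) + f (k - 1) = c f k\<close>, which forces
  \<open>c = 2 cos t\<close> with \<open>cos (n t) = - 1\<close>. For the SMP, a matrix \<open>X\<close> commuting with \<open>C\<close> extends to an
  antiperiodic solution of the discrete wave equation on the plane; as it vanishes on the diagonal
  and next to it, it is constant along all diagonals. The value on the \<open>m\<close>-th diagonal is, up to a
  factor \<open>2 n\<close>, the trace of \<open>(S ^ m + S ^ (- m)) X\<close>, where \<open>C = S + S ^ (- 1)\<close> and \<open>S ^ m + S ^ (- m)\<close>
  is a polynomial of degree \<open>m\<close> in \<open>C\<close>, so it is zero.
\<close>

subsection \<open>Annihilation by the product over the spectrum\<close>

text \<open>The monic polynomial with root list \<open>as\<close>, evaluated at \<open>A\<close> and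
  applied to \<open>v\<close>. With \<open>foldr\<close>, the last list entry acts first.\<close>

definition shift_prod :: "'a::field mat \<Rightarrow> 'a list \<Rightarrow> 'a vec \<Rightarrow> 'a vec" where
  "shift_prod A as = foldr (\<lambda>a v. A *\<^sub>v v - a \<cdot>\<^sub>v v) as"

lemma shift_prod_Nil [simp]: "shift_prod A [] v = v"
  and shift_prod_Cons [simp]:
    "shift_prod A (a # as) v = A *\<^sub>v shift_prod A as v - a \<cdot>\<^sub>v shift_prod A as v"
  by (simp_all add: shift_prod_def)

lemma shift_prod_append: "shift_prod A (as @ bs) v = shift_prod A as (shift_prod A bs v)"
  by (simp add: shift_prod_def)

lemma shift_prod_carrier [simp]:
  assumes "A \<in> carrier_mat n n" "v \<in> carrier_vec n"
  shows "shift_prod A as v \<in> carrier_vec n"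
  using assms by (induction as) auto

section \<open>Commuting the factors \<open>A - a\<close>\<close>

lemma mult_mat_vec_shift:
  fixes A :: "'a::field mat"
  assumes A: "A \<in> carrier_mat n n" and v: "v \<in> carrier_vec n" and w: "w \<in> carrier_vec n"
  shows "A *\<^sub>v (w - c \<cdot>\<^sub>v v) = A *\<^sub>v w - c \<cdot>\<^sub>v (A *\<^sub>v v)"
proof -
  have "A *\<^sub>v (w - c \<cdot>\<^sub>v v) = A *\<^sub>v w - A *\<^sub>v (c \<cdot>\<^sub>v v)"
    by (rule mult_minus_distrib_mat_vec) (use A v w in auto)
  then show ?thesis using mult_mat_vec[OF A v] by simp
qed

lemma shift_prod_swap:
  fixes A :: "'a::field mat"
  assumes A: "A \<in> carrier_mat n n" and v: "v \<in> carrier_vec n"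
  shows "shift_prod A [a, b] v = shift_prod A [b, a] v"
proof -
  have Av: "A *\<^sub>v v \<in> carrier_vec n" "A *\<^sub>v (A *\<^sub>v v) \<in> carrier_vec n"
    using A v by auto
  show ?thesis
    unfolding shift_prod_Cons shift_prod_Nil mult_mat_vec_shift[OF A v Av(1)]
    using A v Av
    by (intro eq_vecI) (auto simp: algebra_simps simp del: index_mult_mat_vec)
qed

lemma shift_prod_snoc:
  fixes A :: "'a::field mat"
  assumes A: "A \<in> carrier_mat n n" and v: "v \<in> carrier_vec n"
  shows "shift_prod A (as @ [b]) v = shift_prod A (b # as) v"
proof (induction as)
  case (Cons a as)
  have "shift_prod A ((a # as) @ [b]) v = shift_prod A [a, b] (shift_prod A as v)"
    using Cons by simp
  also have "\<dots> = shift_prod A [b, a] (shift_prod A as v)"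
    by (rule shift_prod_swap) (use A v in auto)
  finally show ?case by simp
qed simp

lemma shift_prod_commute:
  fixes A :: "'a::field mat"
  assumes A: "A \<in> carrier_mat n n" and v: "v \<in> carrier_vec n"
  shows "shift_prod A as (shift_prod A bs v) = shift_prod A bs (shift_prod A as v)"
proof (induction bs)
  case (Cons b bs)
  have "shift_prod A as (shift_prod A (b # bs) v) = shift_prod A (as @ [b]) (shift_prod A bs v)"
    by (simp add: shift_prod_append)
  also have "\<dots> = shift_prod A [b] (shift_prod A as (shift_prod A bs v))"
    using shift_prod_snoc[OF A, of "shift_prod A bs v" as b] A v by simp
  finally show ?case using Cons by simp
qed simp

text \<open>Since the factors commute, the one for \<open>b\<close> can be made outermost, which
  puts the product in the range of \<open>A - b\<close>.\<close>

lemma shift_prod_split: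
  fixes A :: "'a::field mat"
  assumes A: "A \<in> carrier_mat n n" and v: "v \<in> carrier_vec n" and "b \<in> set as"
  obtains w where "w \<in> carrier_vec n" "shift_prod A as v = A *\<^sub>v w - b \<cdot>\<^sub>v w"
proof -
  from \<open>b \<in> set as\<close> obtain xs ys where as: "as = xs @ b # ys"
    by (meson split_list)
  have "shift_prod A as v = shift_prod A (xs @ [b]) (shift_prod A ys v)"
    by (simp add: as shift_prod_append)
  also have "\<dots> = shift_prod A [b] (shift_prod A (xs @ ys) v)"
    using shift_prod_snoc[OF A, of "shift_prod A ys v" xs b] A v by (simp add: shift_prod_append)
  finally show thesis using that[of "shift_prod A (xs @ ys) v"] A v by simp
qed

text \<open>Symmetry moves one factor across the inner product: for \<open>w = (A - b) v\<close>,
  \<open>w \<bullet> w = ((A - b) w) \<bullet> v = 0\<close>.\<close>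

lemma symmetric_shift_kernel:
  fixes A :: "real mat"
  assumes A: "A \<in> sym_mats n" and v: "v \<in> carrier_vec n"
    and zero: "shift_prod A [b, b] v = 0\<^sub>v n"
  shows "shift_prod A [b] v = 0\<^sub>v n"
proof -
  have A': "A \<in> carrier_mat n n" "transpose_mat A = A"
    using A by (auto simp: sym_mats_def)
  define w where "w = A *\<^sub>v v - b \<cdot>\<^sub>v v"
  have w: "w \<in> carrier_vec n" using A' v by (auto simp: w_def)
  have zero': "A *\<^sub>v w - b \<cdot>\<^sub>v w = 0\<^sub>v n" using zero by (simp add: w_def)
  have Aw: "A *\<^sub>v w \<in> carrier_vec n" "A *\<^sub>v v \<in> carrier_vec n" using A' v w by auto
  have "w \<bullet> w = w \<bullet> (A *\<^sub>v v) - b * (w \<bullet> v)"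
    using w v Aw scalar_prod_minus_distrib[OF w Aw(2), of "b \<cdot>\<^sub>v v"] by (simp add: w_def[symmetric])
  also have "w \<bullet> (A *\<^sub>v v) = (A *\<^sub>v w) \<bullet> v"
    using transpose_vec_mult_scalar[OF A'(1) v w] A'(2) by simp
  also have "(A *\<^sub>v w) \<bullet> v - b * (w \<bullet> v) = (A *\<^sub>v w - b \<cdot>\<^sub>v w) \<bullet> v"
    using minus_scalar_prod_distrib[OF Aw(1) _ v, of "b \<cdot>\<^sub>v w"] w v by simp
  finally have "w \<bullet> w = 0" using zero' v by simp
  \<comment> \<open>Conjugation is trivial over the reals, so definiteness of
    \<open>\<bullet>c\<close> applies.\<close>
  then have "w \<bullet>c w = 0" by (simp add: scalar_prod_def)
  then have "w = 0\<^sub>v n" using conjugate_square_eq_0_vec[OF w] by simp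
  then show ?thesis by (simp add: w_def)
qed

text \<open>Factors of \<open>bs\<close> are cancelled one at a time: each \<open>b\<close> also
  occurs in \<open>as\<close>, so the vector it acts on is \<open>(A - b) w\<close> for some
  \<open>w\<close>, and \<open>(A - b)^2 w = 0\<close> already makes that vector zero. This later
  strips the multiplicities of eigenvalues.\<close>

lemma shift_prod_absorb:
  fixes A :: "real mat"
  assumes A: "A \<in> sym_mats n" and v: "v \<in> carrier_vec n"
    and "set bs \<subseteq> set as" "shift_prod A bs (shift_prod A as v) = 0\<^sub>v n"
  shows "shift_prod A as v = 0\<^sub>v n"
  using assms(3,4)
proof (induction bs)
  case (Cons b bs)
  have A': "A \<in> carrier_mat n n" using A by (auto simp: sym_mats_def)
  let ?u = "shift_prod A bs (shift_prod A as v)"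
  have "?u = shift_prod A as (shift_prod A bs v)"
    by (rule shift_prod_commute[OF A' v])
  then obtain w where w: "w \<in> carrier_vec n" "?u = shift_prod A [b] w"
    using shift_prod_split[OF A', of "shift_prod A bs v" b as] Cons.prems(1) A' v by auto
  have "shift_prod A [b, b] w = shift_prod A [b] ?u"
    unfolding w(2) by simp
  also have "\<dots> = 0\<^sub>v n" using Cons.prems by simp
  finally have "?u = 0\<^sub>v n"
    using symmetric_shift_kernel[OF A w(1)] w(2) by simp
  with Cons show ?case by simp
qed simp

text \<open>The factor of the last listed diagonal entry acts first and shortens the support of the
  vector by one coordinate; after \<open>k\<close> factors nothing is left.\<close>

lemma upper_triangular_shift_prod:
  fixes T :: "'a::field mat"
  assumes T: "T \<in> carrier_mat n n" "upper_triangular T" and "k \<le> n"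
    and "v \<in> carrier_vec n" "\<And>i. k \<le> i \<Longrightarrow> i < n \<Longrightarrow> v $ i = 0"
  shows "shift_prod T (map (\<lambda>i. T $$ (i, i)) [0..<k]) v = 0\<^sub>v n"
  using assms(3-)
proof (induction k arbitrary: v)
  case (Suc k)
  define w where "w = T *\<^sub>v v - T $$ (k, k) \<cdot>\<^sub>v v"
  have w: "w \<in> carrier_vec n" using T Suc.prems by (auto simp: w_def)
  have "w $ i = 0" if "k \<le> i" "i < n" for i
  proof -
    have "(T *\<^sub>v v) $ i = (\<Sum>j\<in>{0..<n}. T $$ (i, j) * v $ j)"
      using T Suc.prems that by (auto simp: scalar_prod_def)
    \<comment> \<open>Terms with \<open>j < k\<close> vanish because \<open>(i, j)\<close> lies
      below the diagonal, terms with \<open>j > k\<close> because \<open>v\<close> is zero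
      there.\<close>
    also have "\<dots> = (\<Sum>j\<in>{0..<n}. if j = k then T $$ (i, k) * v $ k else 0)"
    proof (rule sum.cong)
      fix j assume j: "j \<in> {0..<n}"
      show "T $$ (i, j) * v $ j = (if j = k then T $$ (i, k) * v $ k else 0)"
      proof (cases j k rule: linorder_cases)
        case less
        then show ?thesis using upper_triangularD[OF T(2), of j i] that T by auto
      qed (use Suc.prems(3)[of j] j in auto)
    qed simp
    also have "\<dots> = T $$ (i, k) * v $ k" using Suc.prems by simp
    finally have *: "(T *\<^sub>v v) $ i = T $$ (i, k) * v $ k" .
    have "T $$ (i, k) * v $ k = T $$ (k, k) * v $ i"
      using upper_triangularD[OF T(2), of k i] that T Suc.prems(3)[of i]
      by (cases "i = k") auto
    with * show ?thesis
      using that T Suc.prems by (auto simp: w_def simp del: index_mult_mat_vec)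
  qed
  then have "shift_prod T (map (\<lambda>i. T $$ (i, i)) [0..<k]) w = 0\<^sub>v n"
    using Suc.IH[OF _ w] Suc.prems by auto
  then show ?case by (simp add: shift_prod_append w_def)
qed (auto intro!: eq_vecI)

text \<open>\<open>A P = P T\<close>, so \<open>P\<close> intertwines each factor of
  \<open>T\<close> with the same factor of \<open>A\<close>.\<close>

lemma shift_prod_similar:
  fixes A :: "'a::field mat"
  assumes "similar_mat_wit A T P Q" and A: "A \<in> carrier_mat n n" and u: "u \<in> carrier_vec n"
  shows "shift_prod A as (P *\<^sub>v u) = P *\<^sub>v shift_prod T as u"
proof (induction as)
  case (Cons a as)
  note sim = similar_mat_witD2[OF A assms(1)]
  let ?w = "shift_prod T as u"
  have w: "?w \<in> carrier_vec n" "T *\<^sub>v ?w \<in> carrier_vec n" using sim u by auto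
  have "A *\<^sub>v (P *\<^sub>v ?w) = (A * P) *\<^sub>v ?w"
    by (rule assoc_mult_mat_vec[symmetric]) (use A sim(6) w in auto)
  also have "A * P = P * T"
  proof -
    have "A * P = P * T * Q * P" using sim(3) by simp
    also have "\<dots> = P * T * (Q * P)"
      by (rule assoc_mult_mat) (use sim in auto)
    finally show ?thesis using sim by simp
  qed
  also have "(P * T) *\<^sub>v ?w = P *\<^sub>v (T *\<^sub>v ?w)"
    by (rule assoc_mult_mat_vec) (use sim(5,6) w in auto)
  finally show ?case
    using Cons mult_mat_vec_shift[OF sim(6) w(1) w(2), of a] by simp
qed simp

section \<open>Real eigenvalues of symmetric matrices\<close>

lemma symmetric_eigenvalue_real:
  assumes A: "A \<in> sym_mats n" and ev: "eigenvalue (map_mat complex_of_real A) a"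
  shows "a \<in> \<real>"
proof -
  have sym: "A $$ (i, j) = A $$ (j, i)" if "i < n" "j < n" for i j
    using A that by (auto simp: sym_mats_def) (metis carrier_matD index_transpose_mat(1))
  have A': "A \<in> carrier_mat n n" using A by (auto simp: sym_mats_def)
  obtain v where v: "v \<in> carrier_vec n" "v \<noteq> 0\<^sub>v n"
      "map_mat complex_of_real A *\<^sub>v v = a \<cdot>\<^sub>v v"
    using ev A' by (auto simp: eigenvalue_def eigenvector_def)
  \<comment> \<open>The Hermitian form of \<open>A\<close> at \<open>v\<close>: symmetry makes it
    equal to its conjugate, and the eigenvalue equation makes it \<open>a\<close> times the positive
    squared norm of \<open>v\<close>.\<close>
  define s where "s = (\<Sum>i<n. \<Sum>j<n. of_real (A $$ (i, j)) * v $ j * cnj (v $ i))"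
  have "cnj s = (\<Sum>i<n. \<Sum>j<n. of_real (A $$ (i, j)) * cnj (v $ j) * v $ i)"
    by (simp add: s_def)
  also have "\<dots> = (\<Sum>i<n. \<Sum>j<n. of_real (A $$ (j, i)) * cnj (v $ i) * v $ j)"
    by (rule sum.swap)
  also have "\<dots> = s"
    unfolding s_def by (intro sum.cong refl) (simp add: sym)
  finally have "s \<in> \<real>" by (simp add: Reals_cnj_iff)
  have row: "(\<Sum>j<n. of_real (A $$ (i, j)) * v $ j) = a * v $ i" if "i < n" for i
    using arg_cong[OF v(3), of "\<lambda>w. w $ i"] that A' v(1)
    by (simp add: scalar_prod_def lessThan_atLeast0)
  have "s = (\<Sum>i<n. a * v $ i * cnj (v $ i))"
    unfolding s_def sum_distrib_right[symmetric] by (intro sum.cong refl) (simp add: row)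
  also have "\<dots> = a * of_real (\<Sum>i<n. (cmod (v $ i))\<^sup>2)"
    by (simp add: sum_distrib_left complex_norm_square[symmetric] mult.assoc)
  finally have s: "s = a * of_real (\<Sum>i<n. (cmod (v $ i))\<^sup>2)" .
  obtain i where "i < n" "v $ i \<noteq> 0" using v by (metis carrier_vecD eq_vecI index_zero_vec)
  then have "(\<Sum>i<n. (cmod (v $ i))\<^sup>2) > 0"
    by (intro sum_pos2[of _ i]) auto
  then have "a = s / of_real (\<Sum>i<n. (cmod (v $ i))\<^sup>2)"
    using s by (metis less_irrefl nonzero_mult_div_cancel_right of_real_eq_0_iff)
  then show ?thesis using \<open>s \<in> \<real>\<close> by (metis Reals_divide Reals_of_real)
qed

text \<open>The polynomial splits over the complex numbers with real roots, and injectivity of the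
  embedding of coefficients brings the factorization back to the reals.\<close>

lemma symmetric_char_poly_splits:
  fixes A :: "real mat"
  assumes A: "A \<in> sym_mats n"
  obtains es where "char_poly A = (\<Prod>e\<leftarrow>es. [:- e, 1:])"
proof -
  interpret h: map_poly_inj_comm_ring_hom complex_of_real ..
  have A': "A \<in> carrier_mat n n" using A by (auto simp: sym_mats_def)
  let ?B = "map_mat complex_of_real A"
  have B: "?B \<in> carrier_mat n n" using A' by simp
  obtain as where as: "char_poly ?B = (\<Prod>a\<leftarrow>as. [:- a, 1:])"
    using char_poly_factorized[OF B] by blast
  have real: "of_real (Re a) = a" if "a \<in> set as" for a
  proof -
    have "poly (char_poly ?B) a = 0"
      using that unfolding as by (induction as) auto
    then show ?thesis
      using symmetric_eigenvalue_real[OF A] eigenvalue_root_char_poly[OF B] by simp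
  qed
  have "map_poly complex_of_real (char_poly A) = char_poly ?B"
    by (rule of_real_hom.char_poly_hom[OF A', symmetric])
  also have "\<dots> = (\<Prod>a\<leftarrow>map Re as. [:- complex_of_real a, 1:])"
    unfolding as map_map o_def by (rule arg_cong[of _ _ prod_list], rule map_cong) (auto simp: real)
  also have "\<dots> = map_poly complex_of_real (\<Prod>a\<leftarrow>map Re as. [:- a, 1:])"
    unfolding h.hom_prod_list map_map o_def by (simp add: hom_distribs)
  finally have "char_poly A = (\<Prod>a\<leftarrow>map Re as. [:- a, 1:])"
    by (rule h.injectivity)
  then show thesis using that by blast
qed

text \<open>A Schur decomposition puts the eigenvalues with multiplicity on a triangular diagonal,
  so their full product annihilates every vector (Cayley-Hamilton). Absorption then reduces to a
  list that merely covers the spectrum.\<close>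

lemma symmetric_shift_prod_spectrum:
  fixes A :: "real mat"
  assumes A: "A \<in> sym_mats n" and v: "v \<in> carrier_vec n" and as: "set as = spectrum A"
  shows "shift_prod A as v = 0\<^sub>v n"
proof -
  have A': "A \<in> carrier_mat n n" using A by (auto simp: sym_mats_def)
  obtain es where es: "char_poly A = (\<Prod>e\<leftarrow>es. [:- e, 1:])"
    using symmetric_char_poly_splits[OF A] by blast
  obtain T P Q where sd: "schur_decomposition A es = (T, P, Q)"
    by (metis prod_cases3)
  have sim: "similar_mat_wit A T P Q" and T: "upper_triangular T" "diag_mat T = es"
    using schur_decomposition[OF A' es sd] by auto
  note simD = similar_mat_witD2[OF A' sim]
  have es': "es = map (\<lambda>i. T $$ (i, i)) [0..<n]"
    using T(2) simD(5) by (auto simp: diag_mat_def)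
  have kill: "shift_prod A es w = 0\<^sub>v n" if w: "w \<in> carrier_vec n" for w
  proof -
    have Qw: "Q *\<^sub>v w \<in> carrier_vec n" using simD w by simp
    have "w = P *\<^sub>v (Q *\<^sub>v w)"
      using simD w by (metis assoc_mult_mat_vec one_mult_mat_vec)
    then have "shift_prod A es w = P *\<^sub>v shift_prod T es (Q *\<^sub>v w)"
      using shift_prod_similar[OF sim A' Qw, of es] by simp
    also have "shift_prod T es (Q *\<^sub>v w) = 0\<^sub>v n"
      unfolding es' by (rule upper_triangular_shift_prod) (use simD T Qw in auto)
    finally show ?thesis using simD by (auto intro!: eq_vecI)
  qed
  have "set es = spectrum A"
    unfolding spectrum_root_char_poly[OF A'] es by (induction es) auto
  then show ?thesis
    using shift_prod_absorb[OF A v, of es as] as kill A' v by simp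
qed

subsection \<open>The lower bound\<close>

lemma cycle_edges_iff:
  assumes "i < n" "j < n"
  shows "{i, j} \<in> cycle_edges n \<longleftrightarrow> j = (i + 1) mod n \<or> i = (j + 1) mod n"
  using assms by (auto simp: cycle_edges_def doubleton_eq_iff)

text \<open>An interior row never meets the wrap-around edge between \<open>n - 1\<close> and
  \<open>0\<close>, so it looks tridiagonal.\<close>

lemma graph_mats_cycle_entry:
  assumes A: "A \<in> graph_mats n (cycle_edges n)" and "0 < i" "i + 1 < n" "j < n" "i \<noteq> j"
  shows "A $$ (i, j) \<noteq> 0 \<longleftrightarrow> j = i + 1 \<or> i = j + 1"
proof -
  have "A $$ (i, j) \<noteq> 0 \<longleftrightarrow> {i, j} \<in> cycle_edges n"
    using assms by (auto simp: graph_mats_def)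
  also have "\<dots> \<longleftrightarrow> j = i + 1 \<or> i = j + 1"
    using assms cycle_edges_iff[of i n j] by (cases "j + 1 = n") auto
  finally show ?thesis .
qed

text \<open>After \<open>m\<close> factors the support lies within cyclic distance \<open>m\<close>
  of vertex \<open>0\<close>. As \<open>2 m < n\<close>, position \<open>m\<close> is reached only
  by the walk \<open>0, 1, ..., m\<close>, whose edge weights are nonzero. The vanishing in the gap
  between the two fronts carries the induction.\<close>

lemma cycle_shift_prod_band:
  fixes A :: "real mat"
  assumes A: "A \<in> graph_mats n (cycle_edges n)" and "2 * length as < n"
  defines "w \<equiv> shift_prod A as (unit_vec n 0)"
  shows "w $ length as \<noteq> 0"
    and "\<And>i. length as < i \<Longrightarrow> i + length as < n \<Longrightarrow> w $ i = 0"
proof -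
  have A': "A \<in> carrier_mat n n" using A by (auto simp: graph_mats_def sym_mats_def)
  have "w $ length as \<noteq> 0 \<and> (\<forall>i. length as < i \<and> i + length as < n \<longrightarrow> w $ i = 0)"
    unfolding w_def using assms(2)
  proof (induction as)
    case (Cons a as)
    define u where "u = shift_prod A as (unit_vec n 0)"
    define m where "m = length as"
    have m: "2 * m + 2 < n" using Cons.prems by (simp add: m_def)
    have u: "u \<in> carrier_vec n" using A' by (simp add: u_def)
    have um: "u $ m \<noteq> 0" and u0: "\<And>i. m < i \<Longrightarrow> i + m < n \<Longrightarrow> u $ i = 0"
      using Cons by (auto simp: u_def m_def)
    \<comment> \<open>In this range \<open>i\<close> and its neighbours all lie in the gap of
      \<open>u\<close>, except for the left neighbour \<open>m\<close> of
      \<open>i = m + 1\<close>.\<close>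
    have "(A *\<^sub>v u - a \<cdot>\<^sub>v u) $ i = (if i = m + 1 then A $$ (m + 1, m) * u $ m else 0)"
      if i: "m + 1 \<le> i" "i + m + 1 < n" for i
    proof -
      have "(A *\<^sub>v u) $ i = (\<Sum>j<n. A $$ (i, j) * u $ j)"
        using A' u i by (simp add: scalar_prod_def lessThan_atLeast0)
      also have "\<dots> =
          (\<Sum>j<n. if j = m then if i = m + 1 then A $$ (m + 1, m) * u $ m else 0 else 0)"
      proof (rule sum.cong[OF refl])
        fix j assume j: "j \<in> {..<n}"
        show "A $$ (i, j) * u $ j =
            (if j = m then if i = m + 1 then A $$ (m + 1, m) * u $ m else 0 else 0)"
        proof (cases "j = i \<or> j = i + 1 \<or> i = j + 1")
          case True
          then show ?thesis using u0[of j] i j by auto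
        next
          case False
          then have "A $$ (i, j) = 0"
            using graph_mats_cycle_entry[OF A, of i j] i j by auto
          with False show ?thesis by auto
        qed
      qed
      also have "\<dots> = (if i = m + 1 then A $$ (m + 1, m) * u $ m else 0)"
        using m by simp
      finally show ?thesis using u0[of i] A' u i by (auto simp del: index_mult_mat_vec)
    qed
    moreover have "A $$ (m + 1, m) \<noteq> 0"
      using graph_mats_cycle_entry[OF A, of "m + 1" m] m by auto
    ultimately show ?case using um m by (auto simp: u_def[symmetric] m_def[symmetric])
  qed auto
  then show "w $ length as \<noteq> 0"
    and "\<And>i. length as < i \<Longrightarrow> i + length as < n \<Longrightarrow> w $ i = 0"
    by auto
qed

lemma cycle_num_eigenvalues_ge:
  assumes A: "A \<in> graph_mats n (cycle_edges n)"
  shows "n \<le> 2 * num_eigenvalues A"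
proof (rule ccontr)
  assume less: "\<not> n \<le> 2 * num_eigenvalues A"
  have S: "A \<in> sym_mats n" and A': "A \<in> carrier_mat n n"
    using A by (auto simp: graph_mats_def sym_mats_def)
  obtain as where as: "set as = spectrum A" "distinct as"
    using card_finite_spectrum(1)[OF A'] finite_distinct_list by blast
  then have len: "2 * length as < n"
    using less by (metis distinct_card not_le num_eigenvalues_def)
  have "shift_prod A as (unit_vec n 0) = 0\<^sub>v n"
    using symmetric_shift_prod_spectrum[OF S _ as(1)] by simp
  then show False using cycle_shift_prod_band(1)[OF A len] len by simp
qed

subsection \<open>Antiperiodic functions and twisted cycles\<close>

text \<open>The sign an antiperiodic function picks up between \<open>k mod int n\<close> and
  \<open>k\<close>; \<open>div\<close> rounds down, so negative \<open>k\<close> is covered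
  too.\<close>

definition anti_sign :: "nat \<Rightarrow> int \<Rightarrow> real" where
  "anti_sign n k = (if even (k div int n) then 1 else - 1)"

definition antiperiodic :: "nat \<Rightarrow> (int \<Rightarrow> real) \<Rightarrow> bool" where
  "antiperiodic n f \<longleftrightarrow> (\<forall>k. f (k + int n) = - f k)"

text \<open>The antiperiodic extension of the Kronecker delta at \<open>0\<close>.\<close>

definition anti_delta :: "nat \<Rightarrow> int \<Rightarrow> real" where
  "anti_delta n k = (if int n dvd k then anti_sign n k else 0)"

lemma anti_sign_add [simp]: "n > 0 \<Longrightarrow> anti_sign n (k + int n) = - anti_sign n k"
  by (simp add: anti_sign_def)

lemma anti_sign_small [simp]: "i < n \<Longrightarrow> anti_sign n (int i) = 1"
  by (simp add: anti_sign_def)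

lemma antiperiodic_delta: "n > 0 \<Longrightarrow> antiperiodic n (anti_delta n)"
  by (simp add: antiperiodic_def anti_delta_def)

lemma anti_delta_minus: "n > 0 \<Longrightarrow> anti_delta n (- k) = anti_delta n k"
  by (auto simp: anti_delta_def anti_sign_def dvd_neg_div)

lemma antiperiodic_mult:
  assumes "antiperiodic n f"
  shows "f (k + int n * q) = (if even q then f k else - f k)"
proof (induction q rule: int_induct[where k = 0])
  case (step1 q)
  have "f (k + int n * (q + 1)) = f ((k + int n * q) + int n)" by (simp add: algebra_simps)
  also have "\<dots> = - f (k + int n * q)" using assms by (simp add: antiperiodic_def)
  finally show ?case using step1 by simp
next
  case (step2 q)
  have "f (k + int n * q) = f ((k + int n * (q - 1)) + int n)" by (simp add: algebra_simps)
  also have "\<dots> = - f (k + int n * (q - 1))" using assms by (simp add: antiperiodic_def)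
  finally show ?case using step2 by (auto split: if_splits)
qed simp

lemma antiperiodic_mod:
  assumes "antiperiodic n f"
  shows "f k = anti_sign n k * f (k mod int n)"
  using antiperiodic_mult[OF assms, of "k mod int n" "k div int n"] by (simp add: anti_sign_def)

lemma antiperiodic_eqI:
  assumes "antiperiodic n f" "antiperiodic n g" "n > 0" "\<And>i. i < n \<Longrightarrow> f (int i) = g (int i)"
  shows "f k = g k"
proof -
  have "f (k mod int n) = g (k mod int n)"
    using assms(4)[of "nat (k mod int n)"] assms(3) by (simp add: nat_less_iff)
  then show ?thesis
    using antiperiodic_mod[OF assms(1), of k] antiperiodic_mod[OF assms(2), of k] by simp
qed

lemma antiperiodic_add: "antiperiodic n f \<Longrightarrow> antiperiodic n g \<Longrightarrow> antiperiodic n (\<lambda>k. f k + g k)"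
  by (simp add: antiperiodic_def)

lemma antiperiodic_compose_add: "antiperiodic n f \<Longrightarrow> antiperiodic n (\<lambda>k. f (k + c))"
proof -
  assume f: "antiperiodic n f"
  have "f (k + int n + c) = - f (k + c)" for k
    using f[unfolded antiperiodic_def, rule_format, of "k + c"] by (simp add: algebra_simps)
  then show ?thesis by (simp add: antiperiodic_def)
qed

lemma antiperiodic_compose_minus:
  assumes f: "antiperiodic n f" shows "antiperiodic n (\<lambda>k. f (c - k))"
proof -
  have "f (c - (k + int n)) = - f (c - k)" for k
    using f[unfolded antiperiodic_def, rule_format, of "c - k - int n"] by (simp add: algebra_simps)
  then show ?thesis by (simp add: antiperiodic_def)
qed

text \<open>Exactly one \<open>j\<close> in the window is congruent to \<open>a\<close>, and the
  sign of the delta there turns \<open>f (a mod int n)\<close> back into \<open>f a\<close>.\<close>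

lemma sum_anti_delta:
  assumes f: "antiperiodic n f" and n: "n > 0"
  shows "(\<Sum>j<n. anti_delta n (int j - a) * f (int j)) = f a"
proof -
  define j0 where "j0 = nat (a mod int n)"
  have j0: "int j0 = a mod int n" "j0 < n" using n by (auto simp: j0_def nat_less_iff)
  have "anti_delta n (int j - a) = 0" if "j < n" "j \<noteq> j0" for j
  proof -
    have "int j mod int n \<noteq> a mod int n" using that j0 by auto
    then show ?thesis by (auto simp: anti_delta_def mod_eq_dvd_iff)
  qed
  then have "(\<Sum>j<n. anti_delta n (int j - a) * f (int j)) =
      (\<Sum>j<n. if j = j0 then anti_delta n (int j0 - a) * f (int j0) else 0)"
    by (intro sum.cong) auto
  also have "\<dots> = anti_delta n (int j0 - a) * f (a mod int n)"
    using j0 by simp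
  also have "int j0 - a = int n * (- (a div int n))"
    unfolding j0(1) by (simp add: minus_mult_div_eq_mod[symmetric])
  also have "anti_delta n \<dots> = anti_sign n a"
    using n by (simp add: anti_delta_def anti_sign_def del: mult_minus_right)
  finally show ?thesis using antiperiodic_mod[OF f, of a] by simp
qed

text \<open>With \<open>S\<close> the signed cyclic shift satisfying \<open>S ^ n = - 1\<close>, this is \<open>S ^ m + S ^ (- m)\<close>;
  for \<open>m = 1\<close> it is the adjacency matrix of the cycle with the sign of one edge reversed.\<close>
definition twisted :: "nat \<Rightarrow> nat \<Rightarrow> real mat" where
  "twisted n m = mat n n (\<lambda>(i, j).
     anti_delta n (int j - int i - int m) + anti_delta n (int j - int i + int m))"

lemma twisted_carrier [simp]: "twisted n m \<in> carrier_mat n n"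
  by (simp add: twisted_def)

lemma twisted_dim [simp]: "dim_row (twisted n m) = n" "dim_col (twisted n m) = n"
  by (simp_all add: twisted_def)

lemma twisted_index:
  assumes "i < n" "j < n"
  shows "twisted n m $$ (i, j) =
    anti_delta n (int j - (int i + int m)) + anti_delta n (int j - (int i - int m))"
  using assms by (simp add: twisted_def algebra_simps)

lemma twisted_symmetric:
  assumes "i < n" "j < n"
  shows "twisted n m $$ (i, j) = twisted n m $$ (j, i)"
  using assms anti_delta_minus[of n "int j - (int i + int m)"]
    anti_delta_minus[of n "int j - (int i - int m)"]
  by (simp add: twisted_index algebra_simps)

text \<open>Antiperiodicity absorbs the wrap-around, so multiplication by the matrix becomes a pair
  of shifts on the integers.\<close>

lemma sum_twisted:
  assumes f: "antiperiodic n f" and i: "i < n"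
  shows "(\<Sum>j<n. twisted n m $$ (i, j) * f (int j)) = f (int i + int m) + f (int i - int m)"
proof -
  have "(\<Sum>j<n. twisted n m $$ (i, j) * f (int j)) =
    (\<Sum>j<n. anti_delta n (int j - (int i + int m)) * f (int j)
      + anti_delta n (int j - (int i - int m)) * f (int j))"
    using i by (intro sum.cong refl) (simp add: twisted_index algebra_simps)
  then show ?thesis
    using sum_anti_delta[OF f] i by (simp add: sum.distrib)
qed

lemma twisted_sym_mats: "twisted n m \<in> sym_mats n"
  by (auto simp: sym_mats_def twisted_symmetric intro!: eq_matI)

lemma twisted_graph_mats:
  assumes n: "n \<ge> 3"
  shows "twisted n 1 \<in> graph_mats n (cycle_edges n)"
proof -
  have "twisted n 1 $$ (i, j) \<noteq> 0 \<longleftrightarrow> {i, j} \<in> cycle_edges n" if "i < n" "j < n" for i j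
  proof -
    have mod_iff: "int n dvd int b - (int a + 1) \<longleftrightarrow> b = (a + 1) mod n" if "b < n" for a b
    proof -
      have "int n dvd int b - (int a + 1) \<longleftrightarrow> int b mod int n = int (a + 1) mod int n"
        by (simp add: mod_eq_dvd_iff add.commute)
      also have "\<dots> \<longleftrightarrow> b = (a + 1) mod n"
        using that by (metis mod_less of_nat_eq_iff of_nat_mod)
      finally show ?thesis .
    qed
    have "int n dvd int j - (int i - 1) \<longleftrightarrow> int n dvd int i - (int j + 1)"
      using dvd_minus_iff[of "int n" "int j - (int i - 1)"] by (simp add: algebra_simps)
    then have 2: "int n dvd int j - (int i - 1) \<longleftrightarrow> i = (j + 1) mod n"
      using mod_iff[OF that(1)] by simp
    \<comment> \<open>The neighbours \<open>i + 1\<close> and \<open>i - 1\<close> differ modulo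
      \<open>n\<close> because \<open>n \<ge> 3\<close>, so the two deltas cannot cancel.\<close>
    have "\<not> (int n dvd int j - (int i + 1) \<and> int n dvd int j - (int i - 1))"
    proof
      assume "int n dvd int j - (int i + 1) \<and> int n dvd int j - (int i - 1)"
      then have "int n dvd (int j - (int i - 1)) - (int j - (int i + 1))"
        using dvd_diff by blast
      then have "int n dvd 2" by simp
      then show False using n zdvd_imp_le by fastforce
    qed
    then have "twisted n 1 $$ (i, j) \<noteq> 0 \<longleftrightarrow>
        int n dvd int j - (int i + 1) \<or> int n dvd int j - (int i - 1)"
      using that by (auto simp: twisted_index anti_delta_def anti_sign_def)
    then show ?thesis
      using cycle_edges_iff[OF that] 2 mod_iff[OF that(2)] by simp
  qed
  then show ?thesis by (simp add: graph_mats_def twisted_sym_mats)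
qed

lemma twisted_0: "n > 0 \<Longrightarrow> twisted n 0 = 2 \<cdot>\<^sub>m 1\<^sub>m n"
proof (rule eq_matI)
  fix i j assume ij: "i < dim_row (2 \<cdot>\<^sub>m 1\<^sub>m n :: real mat)" "j < dim_col (2 \<cdot>\<^sub>m 1\<^sub>m n :: real mat)"
  have "int n dvd int j - int i \<longleftrightarrow> i = j"
    using ij mod_eq_dvd_iff[of "int j" "int n" "int i"] by auto
  then show "twisted n 0 $$ (i, j) = (2 \<cdot>\<^sub>m 1\<^sub>m n :: real mat) $$ (i, j)"
    using ij by (auto simp: twisted_index anti_delta_def anti_sign_def)
qed auto

text \<open>The Chebyshev recurrence: \<open>(S + S^(-1)) (S^(m+1) + S^(-(m+1)))\<close> is the sum
  of the terms for \<open>m + 2\<close> and for \<open>m\<close>.\<close>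

lemma twisted_rec:
  assumes n: "n > 0"
  shows "twisted n (Suc (Suc m)) = twisted n 1 * twisted n (Suc m) - twisted n m"
proof (rule eq_matI)
  fix i j
  assume "i < dim_row (twisted n 1 * twisted n (Suc m) - twisted n m)"
    "j < dim_col (twisted n 1 * twisted n (Suc m) - twisted n m)"
  then have ij: "i < n" "j < n" by auto
  \<comment> \<open>Column \<open>j\<close> of \<open>twisted n (Suc m)\<close> as an antiperiodic
    function of the row index.\<close>
  define f where "f =
    (\<lambda>k. anti_delta n (int j - int (Suc m) - k) + anti_delta n (int j + int (Suc m) - k))"
  have f: "antiperiodic n f"
    unfolding f_def
    by (intro antiperiodic_add antiperiodic_compose_minus antiperiodic_delta n)
  have "(twisted n 1 * twisted n (Suc m)) $$ (i, j) = (\<Sum>k<n. twisted n 1 $$ (i, k) * f (int k))"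
    using ij by (simp add: scalar_prod_def lessThan_atLeast0 f_def twisted_index algebra_simps)
  also have "\<dots> = f (int i + 1) + f (int i - 1)"
    using sum_twisted[OF f ij(1), of 1] by simp
  finally show "twisted n (Suc (Suc m)) $$ (i, j) =
      (twisted n 1 * twisted n (Suc m) - twisted n m) $$ (i, j)"
    using ij by (simp add: twisted_index f_def algebra_simps)
qed auto

subsection \<open>The strong multiplicity property\<close>

definition anti_ext :: "nat \<Rightarrow> real mat \<Rightarrow> int \<Rightarrow> int \<Rightarrow> real" where
  "anti_ext n X k l =
     anti_sign n k * anti_sign n l * X $$ (nat (k mod int n), nat (l mod int n))"

lemma anti_ext_of_nat: "i < n \<Longrightarrow> j < n \<Longrightarrow> anti_ext n X (int i) (int j) = X $$ (i, j)"
  by (simp add: anti_ext_def)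

lemma antiperiodic_anti_ext:
  assumes "n > 0"
  shows "antiperiodic n (\<lambda>k. anti_ext n X k l)" "antiperiodic n (\<lambda>l. anti_ext n X k l)"
  using assms by (simp_all add: antiperiodic_def anti_ext_def)

lemma anti_ext_commute:
  assumes X: "X \<in> sym_mats n" and n: "n > 0"
  shows "anti_ext n X k l = anti_ext n X l k"
proof -
  have "X $$ (i, j) = X $$ (j, i)" if "i < n" "j < n" for i j
    using X that by (auto simp: sym_mats_def) (metis carrier_matD index_transpose_mat(1))
  then show ?thesis using n by (simp add: anti_ext_def nat_less_iff)
qed

text \<open>Multiplication by the twisted cycle on the left shifts the row index, on the right, by
  its symmetry, the column index.\<close>

lemma anti_ext_wave:
  assumes X: "X \<in> carrier_mat n n" and n: "n > 0"
    and comm: "twisted n 1 * X = X * twisted n 1"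
  shows "anti_ext n X (k + 1) l + anti_ext n X (k - 1) l =
    anti_ext n X k (l + 1) + anti_ext n X k (l - 1)"
proof -
  let ?F = "anti_ext n X"
  note anti = antiperiodic_anti_ext[OF n, of X]
  have L: "antiperiodic n (\<lambda>k. ?F (k + 1) l + ?F (k - 1) l)" for l
    using antiperiodic_add[OF antiperiodic_compose_add[OF anti(1)[of l], of 1]
        antiperiodic_compose_add[OF anti(1)[of l], of "- 1"]] by simp
  have R: "antiperiodic n (\<lambda>l. ?F k (l + 1) + ?F k (l - 1))" for k
    using antiperiodic_add[OF antiperiodic_compose_add[OF anti(2)[of k], of 1]
        antiperiodic_compose_add[OF anti(2)[of k], of "- 1"]] by simp
  have box: "?F (int i + 1) (int j) + ?F (int i - 1) (int j) =
      ?F (int i) (int j + 1) + ?F (int i) (int j - 1)" if ij: "i < n" "j < n" for i j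
  proof -
    have "(twisted n 1 * X) $$ (i, j) = (\<Sum>k<n. twisted n 1 $$ (i, k) * ?F (int k) (int j))"
      using ij X by (simp add: scalar_prod_def lessThan_atLeast0 anti_ext_of_nat)
    also have "\<dots> = ?F (int i + 1) (int j) + ?F (int i - 1) (int j)"
      using sum_twisted[OF anti(1)[of "int j"] ij(1), of 1] by simp
    finally have 1: "(twisted n 1 * X) $$ (i, j) = \<dots>" .
    have "(X * twisted n 1) $$ (i, j) = (\<Sum>k<n. ?F (int i) (int k) * twisted n 1 $$ (k, j))"
      using ij X by (simp add: scalar_prod_def lessThan_atLeast0 anti_ext_of_nat)
    also have "\<dots> = (\<Sum>k<n. twisted n 1 $$ (j, k) * ?F (int i) (int k))"
      using ij by (intro sum.cong refl) (simp add: twisted_symmetric[of _ n j])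
    also have "\<dots> = ?F (int i) (int j + 1) + ?F (int i) (int j - 1)"
      using sum_twisted[OF anti(2)[of "int i"] ij(2), of 1] by simp
    finally show ?thesis using 1 comm by simp
  qed
  \<comment> \<open>Both sides are antiperiodic in each variable, so the identity spreads from the
    box first in \<open>l\<close>, then in \<open>k\<close>.\<close>
  have "?F (int i + 1) l + ?F (int i - 1) l = ?F (int i) (l + 1) + ?F (int i) (l - 1)"
    if i: "i < n" for i l
    by (rule antiperiodic_eqI[OF antiperiodic_add[OF anti(2) anti(2)] R n]) (rule box[OF i])
  then show ?thesis
    by (rule antiperiodic_eqI[OF L antiperiodic_add[OF anti(1) anti(1)] n])
qed

text \<open>The wave equation at \<open>(k + 1, k + 2 + e)\<close> equates the increment along
  diagonal \<open>e + 2\<close> with that along diagonal \<open>e\<close>. Diagonals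
  \<open>0\<close> and \<open>1\<close> vanish, so by induction all increments are zero.\<close>

lemma wave_eq_toeplitz:
  fixes F :: "int \<Rightarrow> int \<Rightarrow> real"
  assumes wave: "\<And>k l. F (k + 1) l + F (k - 1) l = F k (l + 1) + F k (l - 1)"
    and zero: "\<And>k. F k k = 0" "\<And>k. F k (k + 1) = 0"
  shows "F k (k + int d) = F 0 (int d)"
proof -
  have "F (k + 1) (k + 1 + int d) = F k (k + int d)" for k
  proof (induction d arbitrary: k rule: less_induct)
    case (less d)
    consider "d = 0" | "d = 1" | e where "d = Suc (Suc e)"
      by (metis One_nat_def not0_implies_Suc)
    then show ?case
    proof cases
      case 1
      then show ?thesis by (simp add: zero)
    next
      case 2
      then show ?thesis using zero(2)[of k] zero(2)[of "k + 1"] by simp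
    next
      case (3 e)
      have "F (k + 2) (k + 2 + int e) = F (k + 1) (k + 1 + int e)"
        using less.IH[of e "k + 1"] 3 by (simp add: algebra_simps)
      moreover have "F (k + 1 + 1) (k + 2 + int e) + F (k + 1 - 1) (k + 2 + int e) =
          F (k + 1) (k + 2 + int e + 1) + F (k + 1) (k + 2 + int e - 1)"
        by (rule wave)
      ultimately show ?thesis using 3 by (simp add: algebra_simps)
    qed
  qed
  then have step: "F (k + 1) (k + 1 + int d) = F k (k + int d)" for k .
  show ?thesis
  proof (induction k rule: int_induct[where k = 0])
    case (step2 k)
    then show ?case using step[of "k - 1"] by simp
  qed (use step in auto)
qed

section \<open>Traces against \<open>S^m + S^(-m)\<close>\<close>

lemma trace_twisted_mult:
  assumes X: "X \<in> carrier_mat n n" and n: "n > 0"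
  shows "mat_trace (twisted n m * X) =
    (\<Sum>i<n. anti_ext n X (int i + int m) (int i) + anti_ext n X (int i - int m) (int i))"
  unfolding mat_trace_def
proof (rule sum.cong)
  fix i assume "i \<in> {..<n}"
  then have i: "i < n" by simp
  have "(twisted n m * X) $$ (i, i) =
      (\<Sum>k<n. twisted n m $$ (i, k) * anti_ext n X (int k) (int i))"
    using i X by (simp add: scalar_prod_def lessThan_atLeast0 anti_ext_of_nat)
  then show "(twisted n m * X) $$ (i, i) =
      anti_ext n X (int i + int m) (int i) + anti_ext n X (int i - int m) (int i)"
    using sum_twisted[OF antiperiodic_anti_ext(1)[OF n] i] by simp
qed simp

lemma mat_trace_minus:
  "A \<in> carrier_mat n n \<Longrightarrow> B \<in> carrier_mat n n \<Longrightarrow> mat_trace (A - B) = mat_trace A - mat_trace B"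
  by (simp add: mat_trace_def sum_subtractf)

lemma mat_trace_smult: "A \<in> carrier_mat n n \<Longrightarrow> mat_trace (c \<cdot>\<^sub>m A) = c * mat_trace A"
  by (simp add: mat_trace_def sum_distrib_left)

text \<open>By the recurrence \<open>twisted n m\<close> is a polynomial of degree
  \<open>m < n\<close> in \<open>twisted n 1\<close>, so the trace conditions on powers
  suffice.\<close>

lemma trace_twisted_mult_eq_0:
  assumes X: "X \<in> carrier_mat n n" and n: "n > 0"
    and tr: "\<And>i. i < n \<Longrightarrow> mat_trace (twisted n 1 ^\<^sub>m i * X) = 0"
    and "m < n"
  shows "mat_trace (twisted n m * X) = 0"
proof -
  let ?C = "twisted n 1"
  have pow: "?C ^\<^sub>m i \<in> carrier_mat n n" for i by (rule pow_carrier_mat) simp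
  \<comment> \<open>The extra power \<open>i\<close> lets the recurrence trade a unit of
    \<open>m\<close> for a factor \<open>?C\<close>; the bound \<open>i + m < n\<close> is
    preserved.\<close>
  have "mat_trace (?C ^\<^sub>m i * twisted n m * X) = 0" if "i + m < n" for i
    using that
  proof (induction m arbitrary: i rule: less_induct)
    case (less m)
    consider "m = 0" | "m = 1" | k where "m = Suc (Suc k)"
      by (metis One_nat_def not0_implies_Suc)
    then show ?case
    proof cases
      case 1
      have "?C ^\<^sub>m i * twisted n 0 * X = 2 \<cdot>\<^sub>m (?C ^\<^sub>m i * X)"
        using pow[of i] X by (simp add: twisted_0[OF n] mult_smult_distrib[of _ n n _ n]
            mult_smult_assoc_mat[of _ n n _ n])
      then show ?thesis
        using 1 tr[of i] less.prems mat_trace_smult[OF mult_carrier_mat[OF pow[of i] X], of 2] by simp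
    next
      case 2
      then show ?thesis using tr[of "Suc i"] less.prems by simp
    next
      case (3 k)
      let ?P = "?C ^\<^sub>m i * (?C * twisted n (Suc k)) * X" and ?Q = "?C ^\<^sub>m i * twisted n k * X"
      have "?C ^\<^sub>m i * twisted n m * X = ?P - ?Q"
        unfolding 3 twisted_rec[OF n]
        using mult_minus_distrib_mat[OF pow[of i], of "?C * twisted n (Suc k)" n "twisted n k"]
          minus_mult_distrib_mat[of "?C ^\<^sub>m i * (?C * twisted n (Suc k))" n n "?C ^\<^sub>m i * twisted n k" X n]
          mult_carrier_mat[OF pow[of i]] mult_carrier_mat[of ?C n n "twisted n (Suc k)" n] X
        by simp
      moreover have "?C ^\<^sub>m i * (?C * twisted n (Suc k)) = ?C ^\<^sub>m Suc i * twisted n (Suc k)"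
        using assoc_mult_mat[OF pow[of i] twisted_carrier[of n 1] twisted_carrier[of n "Suc k"]] by simp
      moreover have carr: "?C ^\<^sub>m i * twisted n l * X \<in> carrier_mat n n" for i l
        using mult_carrier_mat[OF mult_carrier_mat[OF pow[of i] twisted_carrier] X] .
      ultimately have "mat_trace (?C ^\<^sub>m i * twisted n m * X) =
          mat_trace (?C ^\<^sub>m Suc i * twisted n (Suc k) * X) - mat_trace ?Q"
        using mat_trace_minus[OF carr[of "Suc i" "Suc k"] carr[of i k]] by (simp only:)
      then show ?thesis using less.IH[of "Suc k" "Suc i"] less.IH[of k i] less.prems 3 by simp
    qed
  qed
  from this[of 0] show ?thesis using \<open>m < n\<close> by simp
qed

lemma twisted_has_SMP:
  assumes n: "n \<ge> 3"
  shows "has_SMP n (twisted n 1)"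
proof -
  have n0: "n > 0" using n by simp
  have "X = 0\<^sub>m n n" if X: "X \<in> sym_mats n"
    and had: "hadamard (twisted n 1) X = 0\<^sub>m n n" and diag: "hadamard (1\<^sub>m n) X = 0\<^sub>m n n"
    and comm: "twisted n 1 * X - X * twisted n 1 = 0\<^sub>m n n"
    and tr: "\<And>i. i < n \<Longrightarrow> mat_trace (twisted n 1 ^\<^sub>m i * X) = 0" for X
  proof -
    let ?F = "anti_ext n X"
    have X': "X \<in> carrier_mat n n" using X by (simp add: sym_mats_def)
    have "twisted n 1 * X = X * twisted n 1"
    proof (rule eq_matI)
      fix i j assume "i < dim_row (X * twisted n 1)" "j < dim_col (X * twisted n 1)"
      then have "i < n" "j < n" using X' by auto
      then show "(twisted n 1 * X) $$ (i, j) = (X * twisted n 1) $$ (i, j)"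
        using arg_cong[OF comm, of "\<lambda>M. M $$ (i, j)"] X' by simp
    qed (use X' in auto)
    note wave = anti_ext_wave[OF X' n0 this]
    have zero0: "?F k k = 0" for k
    proof -
      have "X $$ (i, i) = 0" if "i < n" for i
        using arg_cong[OF diag, of "\<lambda>M. M $$ (i, i)"] that by (simp add: hadamard_def)
      then show ?thesis using n0 by (simp add: anti_ext_def nat_less_iff)
    qed
    \<comment> \<open>Consecutive residues, including \<open>n - 1\<close> and \<open>0\<close>, are
      joined by an edge, so the Hadamard condition clears the whole first diagonal.\<close>
    have zero1: "?F k (k + 1) = 0" for k
    proof -
      define i where "i = nat (k mod int n)"
      define j where "j = nat ((k + 1) mod int n)"
      have ij: "i < n" "j < n" using n0 by (auto simp: i_def j_def nat_less_iff)
      have "int j = int ((i + 1) mod n)"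
        using n0 by (simp add: i_def j_def zmod_int mod_simps add.commute)
      then have j: "j = (i + 1) mod n" by simp
      have "i \<noteq> j" using n ij j by (cases "i + 1 = n") auto
      then have "twisted n 1 $$ (i, j) \<noteq> 0"
        using twisted_graph_mats[OF n] cycle_edges_iff[OF ij] ij j by (simp add: graph_mats_def)
      moreover have "twisted n 1 $$ (i, j) * X $$ (i, j) = 0"
        using arg_cong[OF had, of "\<lambda>M. M $$ (i, j)"] ij by (simp add: hadamard_def)
      ultimately show ?thesis by (simp add: anti_ext_def i_def j_def)
    qed
    note toeplitz = wave_eq_toeplitz[of ?F, OF wave zero0 zero1]
    have F0: "?F 0 (int m) = 0" if "m < n" for m
    proof -
      \<comment> \<open>Symmetry of \<open>X\<close> folds the diagonal \<open>- m\<close> onto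
        \<open>m\<close>, so all \<open>2 n\<close> terms of the trace agree.\<close>
      have "?F (int i + int m) (int i) = ?F 0 (int m)" "?F (int i - int m) (int i) = ?F 0 (int m)" for i
        using toeplitz[of "int i" m] toeplitz[of "int i - int m" m] anti_ext_commute[OF X n0]
        by simp_all
      then have "mat_trace (twisted n m * X) = real n * (2 * ?F 0 (int m))"
        using trace_twisted_mult[OF X' n0, of m] by simp
      then show ?thesis
        using trace_twisted_mult_eq_0[OF X' n0 tr that] n0 by simp
    qed
    \<comment> \<open>The entry lies on diagonal \<open>j - i < n\<close>; entries below the main
      diagonal follow by symmetry.\<close>
    have "?F (int i) (int j) = 0" if "i \<le> j" "j < n" for i j
      using toeplitz[of "int i" "j - i"] F0[of "j - i"] that by simp
    then have "?F (int i) (int j) = 0" if "i < n" "j < n" for i j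
      using that anti_ext_commute[OF X n0, of "int i" "int j"] by (cases i j rule: le_cases) auto
    then show ?thesis
      using X' anti_ext_of_nat[of _ n _ X] by (intro eq_matI) auto
  qed
  then show ?thesis by (auto simp: has_SMP_def twisted_sym_mats)
qed

subsection \<open>The spectrum of the twisted cycle\<close>

text \<open>The scalar form of the recurrence, with
  \<open>2 cos t cos s = cos (s + t) + cos (s - t)\<close>.\<close>

lemma chebyshev_recurrence:
  fixes f :: "int \<Rightarrow> real"
  assumes rec: "\<And>k. f (k + 1) + f (k - 1) = 2 * cos t * f k"
  shows "f (k + int m) + f (k - int m) = 2 * cos (real m * t) * f k"
proof (induction m rule: less_induct)
  case (less m)
  consider "m = 0" | "m = 1" | e where "m = Suc (Suc e)"
    by (metis One_nat_def not0_implies_Suc)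
  then show ?case
  proof cases
    case (3 e)
    \<comment> \<open>\<open>?s\<close> is \<open>(e + 1) t\<close>: the hypotheses concern the
      angles \<open>?s - t\<close> and \<open>?s\<close>, the goal \<open>?s + t\<close>.\<close>
    let ?s = "real e * t + t"
    have IH: "f (k + int e) + f (k - int e) = 2 * cos (?s - t) * f k"
      "f (k + int e + 1) + f (k - int e - 1) = 2 * cos ?s * f k"
      using less.IH[of e] less.IH[of "Suc e"] 3 by (simp_all add: algebra_simps)
    have "f (k + int e + 2) + f (k + int e) = 2 * cos t * f (k + int e + 1)"
      "f (k - int e) + f (k - int e - 2) = 2 * cos t * f (k - int e - 1)"
      using rec[of "k + int e + 1"] rec[of "k - int e - 1"] by (simp_all add: algebra_simps)
    then have "f (k + int e + 2) + f (k - int e - 2) =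
        2 * cos t * (f (k + int e + 1) + f (k - int e - 1)) - (f (k + int e) + f (k - int e))"
      by (simp add: algebra_simps)
    also have "\<dots> = 2 * (2 * cos t * cos ?s - cos (?s - t)) * f k"
      unfolding IH by (simp add: algebra_simps)
    also have "2 * cos t * cos ?s - cos (?s - t) = cos (?s + t)"
      unfolding cos_add[of ?s t] cos_diff[of ?s t] by simp
    finally show ?thesis using 3 by (simp add: algebra_simps)
  qed (use rec[of k] in auto)
qed

text \<open>An eigenvalue is \<open>2 cos t\<close> with \<open>0 \<le> t \<le> pi\<close> and
  \<open>cos (n t) = - 1\<close>, so \<open>n t\<close> is an odd multiple of \<open>pi\<close>
  between \<open>0\<close> and \<open>n pi\<close>.\<close>

lemma twisted_spectrum_subset:
  assumes n: "n > 0"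
  shows "spectrum (twisted n 1) \<subseteq> (\<lambda>r. 2 * cos ((2 * real r + 1) * pi / real n)) ` {..<(n + 1) div 2}"
proof
  fix c assume "c \<in> spectrum (twisted n 1)"
  then obtain v where v: "v \<in> carrier_vec n" "v \<noteq> 0\<^sub>v n" "twisted n 1 *\<^sub>v v = c \<cdot>\<^sub>v v"
    by (auto simp: spectrum_def eigenvalue_def eigenvector_def)
  define f where "f k = anti_sign n k * v $ nat (k mod int n)" for k
  have f: "antiperiodic n f" using n by (simp add: antiperiodic_def f_def)
  have f_nat: "f (int i) = v $ i" if "i < n" for i using that by (simp add: f_def)
  have rec: "f (k + 1) + f (k - 1) = c * f k" for k
  proof (rule antiperiodic_eqI[OF _ _ n])
    show "antiperiodic n (\<lambda>k. f (k + 1) + f (k - 1))"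
      using antiperiodic_add[OF antiperiodic_compose_add[OF f, of 1] antiperiodic_compose_add[OF f, of "- 1"]]
      by simp
    show "antiperiodic n (\<lambda>k. c * f k)" using f by (simp add: antiperiodic_def)
    fix i assume i: "i < n"
    have "(twisted n 1 *\<^sub>v v) $ i = (\<Sum>j<n. twisted n 1 $$ (i, j) * f (int j))"
      using i v(1) by (simp add: scalar_prod_def lessThan_atLeast0 f_nat)
    then show "f (int i + 1) + f (int i - 1) = c * f (int i)"
      using sum_twisted[OF f i, of 1] v(1,3) i by (simp add: f_nat del: index_mult_mat_vec)
  qed
  \<comment> \<open>At an entry of largest modulus the two-neighbour recurrence gives
    \<open>\<bar>c\<bar> \<le> 2\<close>, which makes \<open>arccos (c / 2)\<close>
    meaningful.\<close>
  have "Max ((\<lambda>j. \<bar>v $ j\<bar>) ` {..<n}) \<in> (\<lambda>j. \<bar>v $ j\<bar>) ` {..<n}"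
    using n by (intro Max_in) auto
  then obtain i where i: "i < n" "\<bar>v $ i\<bar> = Max ((\<lambda>j. \<bar>v $ j\<bar>) ` {..<n})" by auto
  have max: "\<bar>v $ j\<bar> \<le> \<bar>v $ i\<bar>" if "j < n" for j
    unfolding i(2) using that by (intro Max_ge) auto
  have "v $ i \<noteq> 0"
  proof
    assume "v $ i = 0"
    then have "v $ j = 0" if "j < n" for j using max[OF that] by simp
    then show False using v(1,2) by (metis carrier_vecD eq_vecI index_zero_vec)
  qed
  have f_le: "\<bar>f k\<bar> \<le> \<bar>v $ i\<bar>" for k
    using max[of "nat (k mod int n)"] n by (simp add: f_def abs_mult anti_sign_def nat_less_iff)
  have "\<bar>c\<bar> * \<bar>v $ i\<bar> = \<bar>f (int i + 1) + f (int i - 1)\<bar>"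
    using i by (simp add: rec f_nat abs_mult)
  also have "\<dots> \<le> 2 * \<bar>v $ i\<bar>"
    using f_le[of "int i + 1"] f_le[of "int i - 1"] by linarith
  finally have "\<bar>c\<bar> \<le> 2" using \<open>v $ i \<noteq> 0\<close> by simp
  define t where "t = arccos (c / 2)"
  have t: "0 \<le> t" "t \<le> pi" "c = 2 * cos t"
    using \<open>\<bar>c\<bar> \<le> 2\<close> by (auto simp: t_def abs_le_iff arccos_lbound arccos_ubound)
  \<comment> \<open>With \<open>m = n\<close>, both shifted values are \<open>- f (int i)\<close>,
    which forces \<open>cos (n t) = - 1\<close>.\<close>
  have "f (int i + int n) + f (int i - int n) = 2 * cos (real n * t) * f (int i)"
    using rec unfolding t(3) by (rule chebyshev_recurrence)
  moreover have "f (int i + int n) = - f (int i)" "f (int i - int n) = - f (int i)"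
    using antiperiodic_mult[OF f, of "int i" 1] antiperiodic_mult[OF f, of "int i" "- 1"] by simp_all
  ultimately have "(cos (real n * t) + 1) * v $ i = 0"
    using i by (simp add: f_nat algebra_simps)
  then have "cos (real n * t) = - 1" using \<open>v $ i \<noteq> 0\<close> by simp
  then have "cos (real n * t - pi) = 1" by simp
  then obtain r :: int where "real n * t - pi = r * (2 * pi)"
    unfolding cos_one_2pi_int by (auto simp: mult.assoc)
  then have r: "real n * t = (2 * r + 1) * pi" by (simp add: algebra_simps)
  have "0 \<le> real n * t" "real n * t \<le> real n * pi"
    using t(1,2) by (simp_all add: mult_left_mono)
  then have "0 \<le> 2 * real_of_int r + 1" "2 * real_of_int r + 1 \<le> real n"
    using pi_gt_zero unfolding r by (auto simp: zero_le_mult_iff)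
  \<comment> \<open>Integrality turns \<open>2 r + 1 \<ge> 0\<close> into
    \<open>r \<ge> 0\<close>.\<close>
  then have r': "0 \<le> r" "2 * r + 1 \<le> int n" by linarith+
  have "t = (2 * real (nat r) + 1) * pi / real n"
    using r r' n by (simp add: field_simps)
  moreover have "nat r < (n + 1) div 2" using r' by linarith
  ultimately show "c \<in> (\<lambda>r. 2 * cos ((2 * real r + 1) * pi / real n)) ` {..<(n + 1) div 2}"
    using t(3) by blast
qed

section \<open>The two bounds combined\<close>

theorem theorem4p11:
  fixes n :: nat
  assumes "n \<ge> 3"
  shows "int (q_M n (cycle_edges n)) = \<lceil>real n / 2\<rceil>"
proof -
  let ?S = "{num_eigenvalues A | A. A \<in> graph_mats n (cycle_edges n) \<and> has_SMP n A}"
  have lower: "(n + 1) div 2 \<le> q" if "q \<in> ?S" for q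
    using that cycle_num_eigenvalues_ge by fastforce
  have mem: "num_eigenvalues (twisted n 1) \<in> ?S"
    using twisted_graph_mats[OF assms] twisted_has_SMP[OF assms] by blast
  \<comment> \<open>The spectrum lies in the image of a set with \<open>(n + 1) div 2\<close>
    elements; the lower bound for this same matrix gives equality.\<close>
  have "num_eigenvalues (twisted n 1) \<le> (n + 1) div 2"
    unfolding num_eigenvalues_def
    using surj_card_le[OF finite_lessThan twisted_spectrum_subset[of n]] assms by simp
  then have "num_eigenvalues (twisted n 1) = (n + 1) div 2"
    using lower[OF mem] by (rule le_antisym)
  then have "(n + 1) div 2 \<in> ?S" using mem by (simp only:)
  \<comment> \<open>The value is attained and is a lower bound, so \<open>Inf\<close> is a true
    minimum here.\<close>
  then have "q_M n (cycle_edges n) = (n + 1) div 2"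
    unfolding q_M_def using lower by (rule cInf_eq_minimum)
  moreover have "\<lceil>real n / 2\<rceil> = int ((n + 1) div 2)"
    by (rule ceiling_unique) (auto simp: field_simps)
  ultimately show ?thesis by simp
qed

end
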